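(* There exists a non-degenerate symmetric probability measure $\mu$ on $\mathsf{Shuffler}(\mathbb{Z})=\mathrm{FSym}(\mathbb{Z})\rtimes\mathbb{Z}$ that induces a transient random walk on $\mathbb{Z}$ and such that the Poisson boundary of $(\mathsf{Shuffler}(\mathbb{Z}),\mu)$ is trivial.
   Context: $\mathrm{FSym}(\mathbb{Z})$ is the group (under composition) of bijections $f:\mathbb{Z}\to\mathbb{Z}$ that are the identity outside a finite set. $\mathbb{Z}$ acts on it by $(h\cdot f)(x)=h+f(x-h)$, and $\mathsf{Shuffler}(\mathbb{Z}):=\mathrm{FSym}(\mathbb{Z})\rtimes\mathbb{Z}$ with product $(f,x)(g,y)=(f\circ(x\cdot g),x+y)$. A probability measure $\mu$ on a countable group $G$ is symmetric if $\mu(g)=\mu(g^{-1})$ for all $g$, and non-degenerate if its support generates $G$ as a semigroup. The $\mu$-random walk is $x_n=g_1\cdots g_n$ with $g_i$ i.i.d. of law $\mu$, started at $e_G$; $\mathbb{P}$ is the law of $(x_1,x_2,\dots)$ on $G^\infty$. The random walk induced on $\mathbb{Z}$ is driven by the push-forward of $\mu$ under the projection $\mathsf{Shuffler}(\mathbb{Z})\to\mathbb{Z}$; it is transient if almost surely it visits $0$ only finitely many times. The Poisson boundary of $(G,\mu)$ is the space of ergodic components of the shift $T(x_1,x_2,\dots)=(x_2,x_3,\dots)$ on $(G^\infty,\mathbb{P})$; it is trivial if every shift-invariant event has $\mathbb{P}$-probability $0$ or $1$. For non-degenerate $\mu$, triviality is equivalent to all bounded functions $f:G\to\mathbb{R}$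 with $f(g)=\sum_{h}f(gh)\mu(h)$ for all $g$ being constant. *)

theory Defs
  imports
    "HOL-Probability.Probability"
    "HOL-Algebra.Elementary_Groups"
    "HOL-Combinatorics.Perm"
begin

section \<open>The group of shufflers\<close>

text \<open>
  The library type \<^typ>\<open>int perm\<close> consists of the bijections of \<^typ>\<open>int\<close> that move only
  finitely many points, and its multiplication is composition.
\<close>

lift_definition translate_perm :: "int \<Rightarrow> int perm \<Rightarrow> int perm"
  is "\<lambda>h f x. h + f (x - h)"
proof -
  fix h :: int and f :: "int \<Rightarrow> int"
  assume "bij f \<and> finite {a. f a \<noteq> a}"
  then have f: "bij f" and fin: "finite {a. f a \<noteq> a}" by auto
  have "bij ((\<lambda>y. h + y) \<circ> f \<circ> (\<lambda>x. x - h))"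
    by (intro bij_comp f) (auto intro!: bij_betw_byWitness[where f' = "\<lambda>x. x - h"]
        bij_betw_byWitness[where f' = "\<lambda>x. x + h"])
  moreover have "{a. h + f (a - h) \<noteq> a} \<subseteq> (\<lambda>y. h + y) ` {a. f a \<noteq> a}"
  proof
    fix a assume "a \<in> {a. h + f (a - h) \<noteq> a}"
    then have "a - h \<in> {a. f a \<noteq> a}" by auto
    then show "a \<in> (\<lambda>y. h + y) ` {a. f a \<noteq> a}" by (rule rev_image_eqI) simp
  qed
  then have "finite {a. h + f (a - h) \<noteq> a}" using fin finite_subset by blast
  ultimately show "bij (\<lambda>x. h + f (x - h)) \<and> finite {a. h + f (a - h) \<noteq> a}"
    by (simp add: comp_def)
qed

definition shuffler_Z :: "(int perm \<times> int) monoid" where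
  "shuffler_Z =
     \<lparr>carrier = UNIV,
      monoid.mult = (\<lambda>(f, x) (g, y). (f * translate_perm x g, x + y)),
      one = (1, 0)\<rparr>"

lemma translate_perm_0 [simp]: "translate_perm 0 f = f"
  by transfer simp

lemma translate_perm_1 [simp]: "translate_perm h 1 = 1"
  by transfer (simp add: fun_eq_iff)

lemma translate_perm_add: "translate_perm (h + k) f = translate_perm h (translate_perm k f)"
  by transfer (simp add: fun_eq_iff algebra_simps)

lemma translate_perm_mult: "translate_perm h (f * g) = translate_perm h f * translate_perm h g"
  by transfer (simp add: fun_eq_iff)

lemma group_shuffler_Z: "group shuffler_Z"
proof (rule groupI)
  fix p assume "p \<in> carrier shuffler_Z"
  obtain f x where p: "p = (f, x)" by (cases p)
  have "translate_perm (- x) (inverse f) * translate_perm (- x) f = 1"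
    by (metis translate_perm_mult translate_perm_1 perm.left_inverse)
  then show "\<exists>q\<in>carrier shuffler_Z. q \<otimes>\<^bsub>shuffler_Z\<^esub> p = \<one>\<^bsub>shuffler_Z\<^esub>"
    unfolding p by (intro bexI[of _ "(translate_perm (- x) (inverse f), - x)"])
      (auto simp: shuffler_Z_def)
qed (auto simp: shuffler_Z_def translate_perm_add translate_perm_mult mult.assoc)

lemma snd_hom_shuffler_Z: "snd \<in> hom shuffler_Z integer_group"
  by (auto simp: hom_def shuffler_Z_def integer_group_def)

lemma countable_int_perm: "countable (UNIV :: int perm set)"
proof -
  let ?g = "\<lambda>f :: int perm. (\<lambda>a. (a, apply f a)) ` affected f"
  have "inj ?g"
  proof (rule injI, rule perm_eqI)
    fix f g :: "int perm" and a
    assume eq: "?g f = ?g g"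
    show "apply f a = apply g a"
    proof (cases "a \<in> affected f \<or> a \<in> affected g")
      case True
      then have "(a, apply f a) \<in> ?g g \<or> (a, apply g a) \<in> ?g f"
        using eq by (metis (no_types, lifting) image_eqI)
      then show ?thesis by auto
    qed (auto simp: in_affected)
  qed
  moreover have "countable (range ?g)"
    by (rule countable_subset[OF _ countable_Collect_finite]) auto
  ultimately show ?thesis
    using countable_image_inj_on by blast
qed

section \<open>Random walks on countable groups\<close>

text \<open>
  A probability measure on a countable group is encoded as a \<^typ>\<open>'a pmf\<close>. The definitions
  concerning the law of the random walk are meant for groups whose elements are all
  the elements of a countable type; then the partial products are measurable.
\<close>

inductive_set semigroup_generated :: "('a, 'b) monoid_scheme \<Rightarrow> 'a set \<Rightarrow> 'a set"
  for G (structure) and S where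
  incl: "x \<in> S \<Longrightarrow> x \<in> semigroup_generated G S"
| mult: "x \<in> semigroup_generated G S \<Longrightarrow> y \<in> semigroup_generated G S
    \<Longrightarrow> x \<otimes> y \<in> semigroup_generated G S"

definition symmetric_pmf :: "('a, 'b) monoid_scheme \<Rightarrow> 'a pmf \<Rightarrow> bool" where
  "symmetric_pmf G \<mu> \<longleftrightarrow> (\<forall>g\<in>carrier G. pmf \<mu> g = pmf \<mu> (inv\<^bsub>G\<^esub> g))"

definition nondegenerate_pmf :: "('a, 'b) monoid_scheme \<Rightarrow> 'a pmf \<Rightarrow> bool" where
  "nondegenerate_pmf G \<mu> \<longleftrightarrow> semigroup_generated G (set_pmf \<mu>) = carrier G"

text \<open>Since sequences are indexed from 0, the increment \<open>g\<^sub>i\<close> is \<open>g (i - 1)\<close>.\<close>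

primrec walk_position :: "('a, 'b) monoid_scheme \<Rightarrow> (nat \<Rightarrow> 'a) \<Rightarrow> nat \<Rightarrow> 'a" where
  "walk_position G g 0 = \<one>\<^bsub>G\<^esub>"
| "walk_position G g (Suc n) = walk_position G g n \<otimes>\<^bsub>G\<^esub> g n"

text \<open>
  The law of \<open>(x\<^sub>1, x\<^sub>2, \<dots>)\<close>: the coordinate with index \<open>n\<close> is \<open>x\<^bsub>n+1\<^esub>\<close>,
  so the deterministic starting point is not part of the trajectory.
\<close>

definition walk_law :: "('a, 'b) monoid_scheme \<Rightarrow> 'a pmf \<Rightarrow> (nat \<Rightarrow> 'a) measure" where
  "walk_law G \<mu> =
     distr (\<Pi>\<^sub>M i\<in>UNIV. measure_pmf \<mu>) (\<Pi>\<^sub>M i\<in>UNIV. count_space UNIV)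
       (\<lambda>g n. walk_position G g (Suc n))"

definition transient_walk :: "('a, 'b) monoid_scheme \<Rightarrow> 'a pmf \<Rightarrow> bool" where
  "transient_walk G \<mu> \<longleftrightarrow> (AE x in walk_law G \<mu>. finite {n. x n = \<one>\<^bsub>G\<^esub>})"

definition path_shift :: "(nat \<Rightarrow> 'a) \<Rightarrow> nat \<Rightarrow> 'a" where
  "path_shift x = (\<lambda>n. x (Suc n))"

definition poisson_boundary_trivial :: "('a, 'b) monoid_scheme \<Rightarrow> 'a pmf \<Rightarrow> bool" where
  "poisson_boundary_trivial G \<mu> \<longleftrightarrow>
     (\<forall>A\<in>sets (walk_law G \<mu>). path_shift -` A = A \<longrightarrow>
        measure (walk_law G \<mu>) A = 0 \<or> measure (walk_law G \<mu>) A = 1)"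

lemma measurable_walk_position:
  fixes \<mu> :: "'a pmf"
  assumes "countable (UNIV :: 'a set)"
  shows "(\<lambda>g n. walk_position G g (Suc n)) \<in>
    (\<Pi>\<^sub>M i\<in>UNIV. measure_pmf \<mu>) \<rightarrow>\<^sub>M (\<Pi>\<^sub>M i\<in>UNIV. count_space UNIV)"
proof -
  let ?P = "\<Pi>\<^sub>M i\<in>(UNIV :: nat set). measure_pmf \<mu>"
  have inc: "(\<lambda>g. g n) \<in> ?P \<rightarrow>\<^sub>M count_space UNIV" for n
  proof -
    have "(\<lambda>g. g n) \<in> ?P \<rightarrow>\<^sub>M measure_pmf \<mu>"
      by (rule measurable_component_singleton) simp
    then show ?thesis
      by (simp cong: measurable_cong_sets)
  qed
  have pos: "(\<lambda>g. walk_position G g n) \<in> ?P \<rightarrow>\<^sub>M count_space UNIV" for n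
  proof (induction n)
    case (Suc n)
    have "(\<lambda>g. (\<lambda>p g. p \<otimes>\<^bsub>G\<^esub> g n) (walk_position G g n) g) \<in> ?P \<rightarrow>\<^sub>M count_space UNIV"
    proof (rule measurable_compose_countable'[OF _ Suc assms])
      fix p
      show "(\<lambda>g. p \<otimes>\<^bsub>G\<^esub> g n) \<in> ?P \<rightarrow>\<^sub>M count_space UNIV"
        by (rule measurable_compose[OF inc]) simp
    qed
    then show ?case by simp
  qed simp
  show ?thesis
  proof (rule measurable_PiM_single')
    show "(\<lambda>g. walk_position G g (Suc n)) \<in> ?P \<rightarrow>\<^sub>M count_space UNIV" for n
      by (rule pos)
  qed simp
qed

lemma prob_space_walk_law:
  fixes \<mu> :: "'a pmf"
  assumes "countable (UNIV :: 'a set)"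
  shows "prob_space (walk_law G \<mu>)"
  unfolding walk_law_def
  by (intro prob_space.prob_space_distr prob_space_PiM measure_pmf.prob_space_axioms
      measurable_walk_position assms)

lemma prob_space_walk_law_shuffler_Z: "prob_space (walk_law shuffler_Z \<mu>)"
proof (rule prob_space_walk_law)
  have "countable ((UNIV :: int perm set) \<times> (UNIV :: int set))"
    by (intro countable_SIGMA countable_int_perm) auto
  then show "countable (UNIV :: (int perm \<times> int) set)" by simp
qed

lemma prob_space_walk_law_integer_group: "prob_space (walk_law integer_group \<mu>)"
  by (rule prob_space_walk_law) simp

end

theory Submission
  imports Defs "HOL-Real_Asymp.Real_Asymp"
begin

text \<open>
  Let \<open>V\<^sub>m\<close> be uniform on \<open>{-m..m}\<close> in the translation subgroup and \<open>U\<^sub>R\<close> uniform on the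
  permutations of \<open>{-R..R}\<close>. The convolution \<open>V\<^sub>m * U\<^bsub>3m\<^esub> * V\<^sub>m\<close> is symmetric. Multiplying it on the left by
  a group element of size \<open>r \<le> m\<close> changes it by at most \<open>r/m\<close> in total variation: the
  finitary part is absorbed by \<open>U\<^bsub>3m\<^esub>\<close>, the translation only shifts \<open>V\<^sub>m\<close>. Mix these measures
  with geometric weights and very rapidly growing scales \<open>m\<^sub>n\<close>. Within about \<open>4\<^sup>n\<close> steps a block
  of index at least \<open>n\<close> is almost certain to occur, and its scale dominates the displacement accumulated
  before; hence bounded harmonic functions are constant. The same large block smears the
  projection to the integers over an interval of length \<open>m\<^sub>n\<close>, so the return probabilities are summable.
\<close>

section \<open>Expectations of functions with values in the unit interval\<close>

lemma integrable_measure_pmf_unit [simp]: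
  fixes f :: "'a \<Rightarrow> real"
  assumes "\<And>x. 0 \<le> f x" "\<And>x. f x \<le> 1"
  shows "integrable (measure_pmf p) f"
  by (rule measure_pmf.integrable_const_bound[where B = 1]) (use assms in auto)

lemma expectation_unit:
  fixes f :: "'a \<Rightarrow> real"
  assumes "\<And>x. 0 \<le> f x" "\<And>x. f x \<le> 1"
  shows "0 \<le> measure_pmf.expectation p f" "measure_pmf.expectation p f \<le> 1"
  using assms by (auto intro!: integral_nonneg_AE measure_pmf.integral_le_const)

lemma ennreal_expectation_unit:
  fixes f :: "'a \<Rightarrow> real"
  assumes "\<And>x. 0 \<le> f x" "\<And>x. f x \<le> 1"
  shows "(\<integral>\<^sup>+ x. ennreal (f x) \<partial>measure_pmf p) = ennreal (measure_pmf.expectation p f)"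
  by (rule nn_integral_eq_integral) (use assms in auto)

text \<open>Nonnegative integrals over a bind iterate without integrability conditions; values in
  the unit interval then allow the return to real expectations.\<close>

lemma expectation_bind_pmf_unit:
  fixes f :: "'b \<Rightarrow> real"
  assumes "\<And>x. 0 \<le> f x" "\<And>x. f x \<le> 1"
  shows "measure_pmf.expectation (bind_pmf p N) f =
    measure_pmf.expectation p (\<lambda>x. measure_pmf.expectation (N x) f)"
proof -
  have "ennreal (measure_pmf.expectation (bind_pmf p N) f) =
      (\<integral>\<^sup>+ x. (\<integral>\<^sup>+ y. ennreal (f y) \<partial>measure_pmf (N x)) \<partial>measure_pmf p)"
    using assms by (simp flip: ennreal_expectation_unit)
  also have "\<dots> = ennreal (measure_pmf.expectation p (\<lambda>x. measure_pmf.expectation (N x) f))"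
    by (simp add: ennreal_expectation_unit assms expectation_unit)
  finally show ?thesis
    by (simp add: assms expectation_unit)
qed

text \<open>The shape of one recursion step: an index below \<open>n\<close> only preserves the old
  bound \<open>a\<close>, while an index at least \<open>n\<close> gives the good bound
  \<open>b\<close>. The bound on \<open>\<bar>X i\<bar>\<close> supplies integrability.\<close>

lemma expectation_le_threshold:
  fixes X :: "nat \<Rightarrow> real"
  assumes X: "\<And>i. \<bar>X i\<bar> \<le> 1" and a: "\<And>i. i < n \<Longrightarrow> X i \<le> a" and b: "\<And>i. n \<le> i \<Longrightarrow> X i \<le> b"
  shows "measure_pmf.expectation p X \<le>
    (1 - measure_pmf.prob p {n..}) * a + measure_pmf.prob p {n..} * b"
proof -
  have "measure_pmf.expectation p X \<le>
      measure_pmf.expectation p (\<lambda>i. a * indicator {..<n} i + b * indicator {n..} i)"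
  proof (rule integral_mono)
    show "integrable (measure_pmf p) X"
      by (rule measure_pmf.integrable_const_bound[where B = 1]) (use X in auto)
  qed (use a b in \<open>auto simp: indicator_def\<close>)
  also have "\<dots> = a * measure_pmf.prob p {..<n} + b * measure_pmf.prob p {n..}"
    by simp
  also have "measure_pmf.prob p {..<n} = 1 - measure_pmf.prob p {n..}"
    using measure_pmf.prob_compl[of "{n..}" p] by (simp add: Compl_eq_Diff_UNIV[symmetric] Compl_atLeast)
  finally show ?thesis by (simp add: mult.commute)
qed


section \<open>Independent increments and conditioning on the first step\<close>

lemma sequence_space_measure_pmf: "sequence_space (measure_pmf p)"
  unfolding sequence_space_def product_prob_space_def product_sigma_finite_def
    product_prob_space_axioms_def
  by (auto intro: measure_pmf.sigma_finite_measure_axioms measure_pmf.prob_space_axioms)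

abbreviation iid :: "'a pmf \<Rightarrow> (nat \<Rightarrow> 'a) measure" where
  "iid p \<equiv> \<Pi>\<^sub>M i\<in>UNIV. measure_pmf p"

lemma space_iid: "space (iid p) = UNIV"
  by (simp add: space_PiM)

lemma prob_space_iid: "prob_space (iid p)"
  by (intro prob_space_PiM measure_pmf.prob_space_axioms)

text \<open>Prepending an independent draw from \<open>p\<close> to an i.i.d. sequence gives an
  i.i.d. sequence again, so Fubini splits off the first increment. Every induction along the walk
  rests on this.\<close>

lemma measure_iid_first_step:
  assumes B: "B \<in> sets (iid p)"
  shows "measure (iid p) B =
    measure_pmf.expectation p (\<lambda>s. measure (iid p) {\<omega>. case_nat s \<omega> \<in> B})"
proof -
  interpret sequence_space "measure_pmf p" by (rule sequence_space_measure_pmf)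
  have meas: "(\<lambda>(s, \<omega>). case_nat s \<omega>) \<in> measure_pmf p \<Otimes>\<^sub>M iid p \<rightarrow>\<^sub>M iid p"
  proof (rule measurable_PiM_single')
    fix i show "(\<lambda>x. (case x of (s, \<omega>) \<Rightarrow> case_nat s \<omega>) i) \<in>
        measure_pmf p \<Otimes>\<^sub>M iid p \<rightarrow>\<^sub>M measure_pmf p"
      by (cases i) (auto simp: split_beta')
  qed (auto simp: space_PiM)
  let ?C = "(\<lambda>(s, \<omega>). case_nat s \<omega>) -` B \<inter> space (measure_pmf p \<Otimes>\<^sub>M iid p)"
  have C: "?C \<in> sets (measure_pmf p \<Otimes>\<^sub>M iid p)"
    using meas B by (rule measurable_sets)
  have "emeasure (iid p) B = emeasure (measure_pmf p \<Otimes>\<^sub>M iid p) ?C"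
    by (subst PiM_iter[symmetric]) (rule emeasure_distr[OF meas B])
  also have "\<dots> = (\<integral>\<^sup>+ s. emeasure (iid p) (Pair s -` ?C) \<partial>measure_pmf p)"
    by (rule P.emeasure_pair_measure_alt[OF C])
  also have "\<dots> = (\<integral>\<^sup>+ s. emeasure (iid p) {\<omega>. case_nat s \<omega> \<in> B} \<partial>measure_pmf p)"
    by (intro nn_integral_cong arg_cong[where f = "emeasure (iid p)"])
      (auto simp: space_pair_measure space_iid)
  also have "(\<integral>\<^sup>+ s. emeasure (iid p) {\<omega>. case_nat s \<omega> \<in> B} \<partial>measure_pmf p) =
      ennreal (measure_pmf.expectation p (\<lambda>s. measure (iid p) {\<omega>. case_nat s \<omega> \<in> B}))"
    by (subst ennreal_expectation_unit[symmetric]) (auto simp: P.emeasure_eq_measure)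
  finally show ?thesis
    by (simp add: P.emeasure_eq_measure expectation_unit)
qed

lemma (in monoid) walk_position_closed:
  assumes "\<And>n. g n \<in> carrier G"
  shows "walk_position G g n \<in> carrier G"
  by (induction n) (use assms in auto)

lemma (in monoid) walk_position_case_nat:
  assumes "s \<in> carrier G" "\<And>n. \<omega> n \<in> carrier G"
  shows "walk_position G (case_nat s \<omega>) (Suc n) = s \<otimes> walk_position G \<omega> n"
proof (induction n)
  case (Suc n)
  then show ?case
    using assms by (simp add: m_assoc walk_position_closed)
qed (use assms in simp)

lemma walk_position_in_sets:
  assumes "countable (UNIV :: 'a set)"
  shows "{\<omega>. walk_position G \<omega> n = (z :: 'a)} \<in> sets (iid p)"
\<comment> \<open>Time 0 is separate because \<open>measurable_walk_position\<close> only covers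
  positive times.\<close>
proof (cases n)
  case 0
  then show ?thesis
    using sets.top[of "iid p"] by (simp add: space_iid)
next
  case (Suc k)
  have "(\<lambda>\<omega>. walk_position G \<omega> (Suc k)) \<in> iid p \<rightarrow>\<^sub>M count_space UNIV"
    using measurable_compose[OF measurable_walk_position[OF assms, of G p]
        measurable_component_singleton[of k]] by simp
  from measurable_sets[OF this, of "{z}"] show ?thesis
    by (simp add: Suc vimage_def space_iid)
qed

section \<open>Transience\<close>

lemma (in group) measure_walk_position_Suc:
  assumes "countable (UNIV :: 'a set)" and G: "carrier G = UNIV"
  shows "measure (iid p) {\<omega>. walk_position G \<omega> (Suc n) = z} =
    measure_pmf.expectation p (\<lambda>s. measure (iid p) {\<omega>. walk_position G \<omega> n = inv s \<otimes> z})"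
proof -
  have "{\<omega>. case_nat s \<omega> \<in> {\<omega>. walk_position G \<omega> (Suc n) = z}} =
      {\<omega>. walk_position G \<omega> n = inv s \<otimes> z}" for s
    using inv_solve_left[of _ s z] by (auto simp: walk_position_case_nat G simp del: walk_position.simps)
  then show ?thesis
    by (subst measure_iid_first_step[OF walk_position_in_sets[OF assms(1)]]) simp
qed

text \<open>This is the first Borel-Cantelli lemma, transported from the increments to the law of
  the trajectory.\<close>

lemma transient_walkI:
  assumes c: "countable (UNIV :: 'a set)"
    and sum: "summable (\<lambda>n. measure (iid p) {\<omega>. walk_position G \<omega> (Suc n) = (\<one>\<^bsub>G\<^esub> :: 'a)})"
  shows "transient_walk G p"
proof -
  interpret I: prob_space "iid p" by (rule prob_space_iid)
  have "AE \<omega> in iid p. \<forall>\<^sub>F n in sequentially.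
      \<omega> \<in> space (iid p) - {\<omega>. walk_position G \<omega> (Suc n) = \<one>\<^bsub>G\<^esub>}"
    by (rule borel_cantelli_AE1[OF walk_position_in_sets[OF c] _ sum])
      (simp add: I.emeasure_eq_measure)
  then have "AE \<omega> in iid p. finite {n. walk_position G \<omega> (Suc n) = \<one>\<^bsub>G\<^esub>}"
    by (rule AE_mp) (auto simp: cofinite_eq_sequentially[symmetric] eventually_cofinite space_iid)
  moreover have "Measurable.pred (\<Pi>\<^sub>M i\<in>(UNIV :: nat set). count_space (UNIV :: 'a set))
      (\<lambda>x. finite {n. x n = \<one>\<^bsub>G\<^esub>})"
  proof -
    \<comment> \<open>Finiteness is rewritten with countable quantifiers to make the event
      measurable.\<close>
    have "finite {n. x n = \<one>\<^bsub>G\<^esub>} \<longleftrightarrow> (\<exists>N. \<forall>n\<ge>N. x n \<noteq> \<one>\<^bsub>G\<^esub>)" for x :: "nat \<Rightarrow> 'a"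
      using MOST_nat_le[of "\<lambda>n. x n \<noteq> \<one>\<^bsub>G\<^esub>"] by (simp add: eventually_cofinite)
    then show ?thesis by simp
  qed
  ultimately show ?thesis
    unfolding transient_walk_def walk_law_def
    by (subst AE_distr_iff[OF measurable_walk_position[OF c]]) (simp_all add: pred_def)
qed

section \<open>Triviality of the Poisson boundary from the Liouville property\<close>

text \<open>For a shift-invariant event, the probability \<open>h a\<close> that the walk started at
  \<open>a\<close> lies in it is harmonic in \<open>a\<close>, hence constant. The event is then
  independent of the first \<open>n\<close> increments for every \<open>n\<close>, so of itself, and
  its probability equals its own square.\<close>

lemma (in group) poisson_boundary_trivialI:
  assumes c: "countable (UNIV :: 'a set)" and G: "carrier G = UNIV"
    and liouville: "\<And>h :: 'a \<Rightarrow> real. (\<And>a. 0 \<le> h a) \<Longrightarrow> (\<And>a. h a \<le> 1) \<Longrightarrow>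
      (\<And>a. h a = measure_pmf.expectation p (\<lambda>s. h (a \<otimes> s))) \<Longrightarrow> (\<And>a. h a = h \<one>)"
  shows "poisson_boundary_trivial G p"
  unfolding poisson_boundary_trivial_def
proof (intro ballI impI)
  interpret I: prob_space "iid p" by (rule prob_space_iid)
  let ?T = "\<Pi>\<^sub>M i\<in>(UNIV :: nat set). count_space (UNIV :: 'a set)"
  fix A assume A: "A \<in> sets (walk_law G p)" and inv: "path_shift -` A = A"
  then have AT: "A \<in> sets ?T" by (simp add: walk_law_def)
  \<comment> \<open>The trajectory started at \<open>a\<close>, with the starting point left out as
    in \<open>walk_law\<close>.\<close>
  define path where "path a g = (\<lambda>n. a \<otimes> walk_position G g (Suc n))" for a g
  define E where "E a = {g. path a g \<in> A}" for a
  define h where "h a = measure (iid p) (E a)" for a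
  have path_meas: "path a \<in> iid p \<rightarrow>\<^sub>M ?T" for a
  proof (rule measurable_PiM_single')
    fix i :: nat
    show "(\<lambda>g. path a g i) \<in> iid p \<rightarrow>\<^sub>M count_space UNIV"
      using measurable_compose[OF measurable_compose[OF measurable_walk_position[OF c, of G p]
        measurable_component_singleton[of i]], of "\<lambda>x. a \<otimes> x"] by (simp add: path_def)
  qed simp
  have E_meas: "E a \<in> sets (iid p)" for a
    using measurable_sets[OF path_meas AT, of a] by (simp add: E_def vimage_def space_iid)
  have "path_shift (path a (case_nat s g)) = path (a \<otimes> s) g" for a s g
    by (simp add: path_shift_def path_def walk_position_case_nat G m_assoc fun_eq_iff
        del: walk_position.simps)
  then have "path a (case_nat s g) \<in> path_shift -` A \<longleftrightarrow> path (a \<otimes> s) g \<in> A" for a s g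
    by (simp only: vimage_eq)
  \<comment> \<open>Invariance enters here: deleting the first position does not change membership
    in \<open>A\<close>, and the rest is a walk started at \<open>a \<otimes> s\<close>.\<close>
  then have E_step: "case_nat s g \<in> E a \<longleftrightarrow> g \<in> E (a \<otimes> s)" for a s g
    unfolding inv by (simp only: E_def mem_Collect_eq)
  have h_harmonic: "h a = measure_pmf.expectation p (\<lambda>s. h (a \<otimes> s))" for a
    unfolding h_def by (subst measure_iid_first_step[OF E_meas]) (simp add: E_step)
  have h: "h a = h \<one>" for a
    by (rule liouville[of h, OF _ _ h_harmonic]) (simp_all add: h_def)
  \<comment> \<open>Both \<open>a\<close> and \<open>X\<close> vary in the induction, since a first
    step \<open>s\<close> moves the start to \<open>a \<otimes> s\<close> and shifts the
    constraints. The factor stays \<open>h \<one>\<close> because \<open>h\<close> is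
    constant.\<close>
  have indep: "measure (iid p) (E a \<inter> {g. \<forall>i<n. g i \<in> X i}) =
      h \<one> * measure (iid p) {g. \<forall>i<n. g i \<in> X i}" for a n and X :: "nat \<Rightarrow> 'a set"
  proof (induction n arbitrary: a X)
    case 0
    then show ?case using h[of a] I.prob_space by (simp add: h_def space_iid)
  next
    case (Suc n)
    have C: "{g. \<forall>i<Suc n. g i \<in> X i} \<in> sets (iid p)"
    proof -
      have "{g. \<forall>i<Suc n. g i \<in> X i} = (\<Inter>i\<in>{..n}. (\<lambda>g. g i) -` X i \<inter> space (iid p))"
        by (auto simp: space_iid less_Suc_eq_le)
      also have "\<dots> \<in> sets (iid p)"
        by (intro sets.finite_INT measurable_sets[OF measurable_component_singleton]) auto
      finally show ?thesis .
    qed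
    have st: "case_nat s g \<in> {g. \<forall>i<Suc n. g i \<in> X i} \<longleftrightarrow>
       s \<in> X 0 \<and> g \<in> {g. \<forall>i<n. g i \<in> X (Suc i)}" for s g
      by (auto simp: less_Suc_eq_0_disj)
    have "measure (iid p) (E a \<inter> {g. \<forall>i<Suc n. g i \<in> X i}) = 
      measure_pmf.expectation p (\<lambda>s. measure (iid p)
         {g. s \<in> X 0 \<and> g \<in> E (a \<otimes> s) \<inter> {g. \<forall>i<n. g i \<in> X (Suc i)}})"
      by (subst measure_iid_first_step[OF sets.Int[OF E_meas C]])
        (simp only: Int_iff E_step st conj_ac)
    also have "\<dots> = measure_pmf.expectation p (\<lambda>s. h \<one> * measure (iid p)
         {g. s \<in> X 0 \<and> g \<in> {g. \<forall>i<n. g i \<in> X (Suc i)}})"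
    proof (intro Bochner_Integration.integral_cong refl)
      fix s show "measure (iid p) {g. s \<in> X 0 \<and> g \<in> E (a \<otimes> s) \<inter> {g. \<forall>i<n. g i \<in> X (Suc i)}} =
         h \<one> * measure (iid p) {g. s \<in> X 0 \<and> g \<in> {g. \<forall>i<n. g i \<in> X (Suc i)}}"
        using Suc[of "a \<otimes> s" "\<lambda>i. X (Suc i)"] by (cases "s \<in> X 0") (simp_all add: Int_def)
    qed
    also have "\<dots> = h \<one> * measure (iid p) {g. \<forall>i<Suc n. g i \<in> X i}"
      by (subst measure_iid_first_step[OF C]) (simp only: st integral_mult_right_zero)
    finally show ?case .
  qed
  \<comment> \<open>Independence from cylinders, stated as an equality of finite measures, extends
    to all measurable sets.\<close>
  have "density (iid p) (indicator (E \<one>)) = scale_measure (ennreal (h \<one>)) (iid p)"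
  proof (rule measure_eqI_PiM_infinite)
    fix X :: "nat \<Rightarrow> 'a set" and J :: "nat set"
    assume J: "finite J" "J \<subseteq> UNIV" "\<And>i. i \<in> J \<Longrightarrow> X i \<in> sets (measure_pmf p)"
    obtain n where n: "J \<subseteq> {..<n}" using finite_nat_bounded[OF J(1)] by blast
    let ?C = "prod_emb UNIV (\<lambda>_. measure_pmf p) J (Pi\<^sub>E J X)"
    have C: "?C \<in> sets (iid p)" using J by (intro sets_PiM_I) auto
    \<comment> \<open>A cylinder over \<open>J\<close> becomes one over an initial segment, with no
      constraint outside \<open>J\<close>.\<close>
    have "?C = {g. \<forall>i<n. g i \<in> (if i \<in> J then X i else UNIV)}"
      using n by (auto simp: prod_emb_def PiE_iff space_PiM subset_iff)
    then have "measure (iid p) (E \<one> \<inter> ?C) = h \<one> * measure (iid p) ?C"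
      using indep[of \<one> n "\<lambda>i. if i \<in> J then X i else UNIV"] by simp
    then show "emeasure (density (iid p) (indicator (E \<one>))) ?C =
        emeasure (scale_measure (ennreal (h \<one>)) (iid p)) ?C"
      using C E_meas[of \<one>]
      by (simp add: emeasure_restricted I.emeasure_eq_measure ennreal_mult' h_def)
  next
    show "finite_measure (density (iid p) (indicator (E \<one>)))"
      by (rule finite_measureI)
        (use E_meas[of \<one>] in \<open>simp add: emeasure_restricted I.emeasure_eq_measure\<close>)
  qed simp_all
  \<comment> \<open>Testing the equality on the event itself.\<close>
  from arg_cong[OF this, of "\<lambda>M. emeasure M (E \<one>)"]
  have "ennreal (h \<one>) = ennreal (h \<one> * h \<one>)"
    using E_meas[of \<one>]
    by (simp add: emeasure_restricted I.emeasure_eq_measure ennreal_mult' h_def)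
  then have "h \<one> = h \<one> * h \<one>" by (simp add: h_def)
  then have "h \<one> = 0 \<or> h \<one> = 1" by auto
  moreover have "measure (walk_law G p) A = h \<one>"
    unfolding walk_law_def
    by (subst measure_distr[OF measurable_walk_position[OF c] AT])
      (simp add: h_def E_def path_def vimage_def space_iid G)
  ultimately show "measure (walk_law G p) A = 0 \<or> measure (walk_law G p) A = 1" by simp
qed

section \<open>A symmetric measure on shufflers\<close>

lemma carrier_shuffler_Z [simp]: "carrier shuffler_Z = UNIV"
  by (simp add: shuffler_Z_def)

lemma mult_shuffler_Z [simp]:
  "(f, x) \<otimes>\<^bsub>shuffler_Z\<^esub> (g, y) = (f * translate_perm x g, x + y)"
  by (simp add: shuffler_Z_def)

lemma translate_perm_inverse: "translate_perm h (inverse f) = inverse (translate_perm h f)"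
proof -
  have "translate_perm h (inverse f) * translate_perm h f = 1"
    by (metis translate_perm_mult translate_perm_1 perm.left_inverse)
  then show ?thesis
    by (metis perm.inverse_unique perm.inverse_inverse)
qed

lemma inv_shuffler_Z: "inv\<^bsub>shuffler_Z\<^esub> (f, x) = (translate_perm (- x) (inverse f), - x)"
proof (rule group.inv_equality[OF group_shuffler_Z])
  show "(translate_perm (- x) (inverse f), - x) \<otimes>\<^bsub>shuffler_Z\<^esub> (f, x) = \<one>\<^bsub>shuffler_Z\<^esub>"
    by (simp add: shuffler_Z_def translate_perm_mult[symmetric])
qed simp_all

lemma countable_shuffler: "countable (UNIV :: (int perm \<times> int) set)"
  using countable_SIGMA[OF countable_int_perm, of "\<lambda>_. UNIV :: int set"] by simp

section \<open>Finite boxes of permutations and balls of shufflers\<close>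

lemma affected_translate_perm: "affected (translate_perm h f) = (\<lambda>a. h + a) ` affected f"
proof -
  have "a \<in> affected (translate_perm h f) \<longleftrightarrow> a - h \<in> affected f" for a
    unfolding in_affected by transfer auto
  then show ?thesis
    by (auto intro: image_eqI[where x = "_ - h"])
qed

text \<open>The symmetric group on \<open>{- R..R}\<close>, extended by the identity. Being a finite
  subgroup, it carries a uniform measure invariant under its own multiplications.\<close>

definition box_perms :: "int \<Rightarrow> int perm set" where
  "box_perms R = {p. affected p \<subseteq> {- R..R}}"

lemma one_in_box_perms [simp]: "1 \<in> box_perms R"
  by (simp add: box_perms_def)

lemma box_perms_mult: "p \<in> box_perms R \<Longrightarrow> q \<in> box_perms R \<Longrightarrow> p * q \<in> box_perms R"
  using subsetD[OF affected_times[of p q]] by (fastforce simp: box_perms_def)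

lemma box_perms_inverse [simp]: "inverse p \<in> box_perms R \<longleftrightarrow> p \<in> box_perms R"
  by (simp add: box_perms_def)

text \<open>With \<open>x = 0\<close> this also serves as monotonicity of the boxes in the
  radius.\<close>

lemma box_perms_translate:
  "p \<in> box_perms R \<Longrightarrow> \<bar>x\<bar> + R \<le> S \<Longrightarrow> translate_perm x p \<in> box_perms S"
  by (fastforce simp: box_perms_def affected_translate_perm)

text \<open>Such a permutation is determined by its restriction to the box, which is a self-map of a
  finite set.\<close>

lemma finite_box_perms [simp]: "finite (box_perms R)"
proof (rule inj_on_finite)
  show "inj_on (\<lambda>p. restrict (apply p) {- R..R}) (box_perms R)"
  proof (rule inj_onI, rule perm_eqI)
    fix p q :: "int perm" and a
    assume "p \<in> box_perms R" "q \<in> box_perms R"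
      and eq: "restrict (apply p) {- R..R} = restrict (apply q) {- R..R}"
    then have "a \<notin> affected p" "a \<notin> affected q" if "a \<notin> {- R..R}"
      using that by (auto simp: box_perms_def)
    then have "a \<notin> {- R..R} \<Longrightarrow> apply p a = apply q a"
      by (simp add: in_affected)
    moreover have "a \<in> {- R..R} \<Longrightarrow> apply p a = apply q a"
      using fun_cong[OF eq, of a] by (simp only: restrict_apply if_True)
    ultimately show "apply p a = apply q a" by blast
  qed
  show "(\<lambda>p. restrict (apply p) {- R..R}) ` box_perms R \<subseteq> {- R..R} \<rightarrow>\<^sub>E {- R..R}"
  proof clarify
    fix p assume p: "p \<in> box_perms R"
    have "apply p a \<in> {- R..R}" if "a \<in> {- R..R}" for a
      using p that apply_affected[of p a]
      by (cases "a \<in> affected p") (auto simp: box_perms_def subset_iff in_affected)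
    then show "restrict (apply p) {- R..R} \<in> {- R..R} \<rightarrow>\<^sub>E {- R..R}"
      by auto
  qed
qed (auto intro: finite_PiE)

lemma box_perms_nonempty [simp]: "box_perms R \<noteq> {}"
  using one_in_box_perms by blast

text \<open>Not a ball of a word metric: the radius bounds both the affected points and the
  translation. Radii add under multiplication, and the balls exhaust the group.\<close>

definition shuffler_ball :: "int \<Rightarrow> (int perm \<times> int) set" where
  "shuffler_ball r = box_perms r \<times> {- r..r}"

lemma shuffler_ball_mult:
  assumes "g \<in> shuffler_ball r" "h \<in> shuffler_ball s"
  shows "g \<otimes>\<^bsub>shuffler_Z\<^esub> h \<in> shuffler_ball (r + s)"
proof -
  obtain p y q z where gh: "g = (p, y)" "h = (q, z)" by fastforce
  have "p \<in> box_perms (r + s)" "translate_perm y q \<in> box_perms (r + s)"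
    using assms box_perms_translate[of p r 0 "r + s"] box_perms_translate[of q s y "r + s"]
    by (auto simp: gh shuffler_ball_def)
  then show ?thesis
    using assms by (auto simp: gh shuffler_ball_def box_perms_mult)
qed

lemma shuffler_ball_exhausts: "\<exists>r\<ge>0. g \<in> shuffler_ball r"
proof -
  obtain p y where g: "g = (p, y)" by fastforce
  obtain k where k: "\<And>a. a \<in> affected p \<Longrightarrow> \<bar>a\<bar> \<le> k"
    using bdd_above_finite[of "abs ` affected p"] by (auto simp: bdd_above_def)
  have "affected p \<subseteq> {- max k \<bar>y\<bar>..max k \<bar>y\<bar>}"
    using k by fastforce
  then have "g \<in> shuffler_ball (max k \<bar>y\<bar>)"
    by (auto simp: g shuffler_ball_def box_perms_def)
  then show ?thesis by (intro exI[of _ "max k \<bar>y\<bar>"]) auto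
qed

text \<open>The sampled element is the product of \<open>(1, x)\<close>, \<open>(p, 0)\<close> and
  \<open>(1, z)\<close>, multiplied out. The first translation hides a shift of the start, the
  second spreads the position on the integers.\<close>

definition block_pmf :: "int \<Rightarrow> (int perm \<times> int) pmf" where
  "block_pmf m = do {
     x \<leftarrow> pmf_of_set {- m..m};
     p \<leftarrow> pmf_of_set (box_perms (3 * m));
     z \<leftarrow> pmf_of_set {- m..m};
     return_pmf (translate_perm x p, x + z)}"

text \<open>The ratio of consecutive scales, \<open>16 ^ (2 * n + 1)\<close>, beats the roughly
  \<open>4 ^ n\<close> steps spent waiting for a larger block.\<close>

definition block_scale :: "nat \<Rightarrow> int" where
  "block_scale n = 16 ^ (n\<^sup>2)"

definition shuffler_pmf :: "(int perm \<times> int) pmf" where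
  "shuffler_pmf = bind_pmf (geometric_pmf (1/2)) (\<lambda>n. block_pmf (block_scale n))"

lemma block_scale_mono: "i \<le> n \<Longrightarrow> block_scale i \<le> block_scale n"
  by (simp add: block_scale_def power_increasing)

lemma block_scale_pos [simp]: "0 < block_scale n" "0 \<le> block_scale n"
  by (simp_all add: block_scale_def)

lemma block_scale_ge: "int n \<le> block_scale n"
proof -
  have "n < 16 ^ n" by (rule power_gt_expt) simp
  also have "(16 :: nat) ^ n \<le> 16 ^ (n\<^sup>2)"
    by (intro power_increasing) (simp_all add: power2_eq_square)
  finally have "int n < int (16 ^ (n\<^sup>2))" by (simp only: of_nat_less_iff)
  then show ?thesis by (simp add: block_scale_def)
qed

lemma set_block_pmf:
  assumes "0 \<le> m"
  shows "set_pmf (block_pmf m) \<subseteq> shuffler_ball (4 * m)"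
  using assms
  by (auto simp: block_pmf_def shuffler_ball_def intro!: box_perms_translate[where R = "3 * m"])

text \<open>Inversion reverses the three factors and inverts each. The outer factors have the same
  law, and all three uniform laws are invariant under inversion.\<close>

lemma inv_block_pmf:
  assumes "0 \<le> m"
  shows "map_pmf (m_inv shuffler_Z) (block_pmf m) = block_pmf m"
proof -
  let ?U = "pmf_of_set {- m..m}" and ?V = "pmf_of_set (box_perms (3 * m))"
  have U: "map_pmf uminus ?U = ?U"
    using assms by (intro map_pmf_of_set_bij_betw) (auto intro!: bij_betwI[where g = uminus])
  have V: "map_pmf inverse ?V = ?V"
    by (intro map_pmf_of_set_bij_betw) (auto intro!: bij_betwI[where g = inverse])
  have "block_pmf m = bind_pmf (map_pmf uminus ?U) (\<lambda>x. bind_pmf (map_pmf inverse ?V) (\<lambda>p.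
      bind_pmf (map_pmf uminus ?U) (\<lambda>z. return_pmf (translate_perm x p, x + z))))"
    by (simp only: U V block_pmf_def)
  also have "\<dots> = bind_pmf ?U (\<lambda>x. bind_pmf ?V (\<lambda>p. bind_pmf ?U (\<lambda>z.
      return_pmf (translate_perm (- x) (inverse p), - x - z))))"
    by (simp add: bind_map_pmf)
  \<comment> \<open>Three commutations of independent draws exchange the roles of \<open>x\<close>
    and \<open>z\<close>.\<close>
  also have "\<dots> = bind_pmf ?U (\<lambda>x. bind_pmf ?U (\<lambda>z. bind_pmf ?V (\<lambda>p.
      return_pmf (translate_perm (- x) (inverse p), - x - z))))"
    by (subst bind_commute_pmf) (rule refl)
  also have "\<dots> = bind_pmf ?U (\<lambda>z. bind_pmf ?U (\<lambda>x. bind_pmf ?V (\<lambda>p.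
      return_pmf (translate_perm (- x) (inverse p), - x - z))))"
    by (rule bind_commute_pmf)
  also have "\<dots> = bind_pmf ?U (\<lambda>z. bind_pmf ?V (\<lambda>p. bind_pmf ?U (\<lambda>x.
      return_pmf (translate_perm (- x) (inverse p), - x - z))))"
    by (subst bind_commute_pmf) (rule refl)
  also have "\<dots> = map_pmf (m_inv shuffler_Z) (block_pmf m)"
  proof -
    have "inv\<^bsub>shuffler_Z\<^esub> (translate_perm x p, x + z) = (translate_perm (- z) (inverse p), - z - x)"
      for x p z
      by (simp add: inv_shuffler_Z translate_perm_inverse flip: translate_perm_add)
    then show ?thesis
      by (simp only: block_pmf_def map_bind_pmf map_return_pmf)
  qed
  finally show ?thesis by simp
qed

lemma symmetric_shuffler_pmf: "symmetric_pmf shuffler_Z shuffler_pmf"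
  unfolding symmetric_pmf_def
proof
  fix g
  interpret group shuffler_Z by (rule group_shuffler_Z)
  have "map_pmf (m_inv shuffler_Z) shuffler_pmf = shuffler_pmf"
    by (simp add: shuffler_pmf_def map_bind_pmf inv_block_pmf)
  moreover have "inj (m_inv shuffler_Z)"
    using inv_inj by simp
  ultimately show "pmf shuffler_pmf g = pmf shuffler_pmf (inv\<^bsub>shuffler_Z\<^esub> g)"
    using pmf_map_inj'[of "m_inv shuffler_Z" shuffler_pmf g] by simp
qed

text \<open>A block of large enough scale produces \<open>(p, y)\<close> directly, by drawing
  \<open>0\<close>, then \<open>p\<close>, then \<open>y\<close>.\<close>

lemma set_shuffler_pmf: "set_pmf shuffler_pmf = UNIV"
proof -
  have "g \<in> set_pmf shuffler_pmf" for g
  proof -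
    obtain p y where g: "g = (p, y)" by fastforce
    obtain r where r: "0 \<le> r" "g \<in> shuffler_ball r" using shuffler_ball_exhausts by blast
    define m where "m = block_scale (nat r)"
    have m: "r \<le> m" using block_scale_ge[of "nat r"] r by (simp add: m_def)
    have "p \<in> box_perms (3 * m)" "y \<in> {- m..m}"
      using r m box_perms_translate[of p r 0 "3 * m"] by (auto simp: g shuffler_ball_def)
    then have "g \<in> set_pmf (block_pmf m)"
      using r m unfolding block_pmf_def set_bind_pmf g
      by (intro UN_I[of "0 :: int"] UN_I[of p] UN_I[of y]) simp_all
    then show ?thesis
      by (auto simp: shuffler_pmf_def set_pmf_geometric m_def)
  qed
  then show ?thesis by blast
qed

lemma nondegenerate_shuffler_pmf: "nondegenerate_pmf shuffler_Z shuffler_pmf"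
  by (auto simp: nondegenerate_pmf_def set_shuffler_pmf intro: semigroup_generated.incl)

section \<open>Averaging over the random block index\<close>

lemma prob_geometric_half_atLeast: "measure_pmf.prob (geometric_pmf (1/2)) {n..} = 1 / 2 ^ n"
proof -
  have "measure_pmf.prob (geometric_pmf (1/2)) {..<n} = (\<Sum>k<n. (1/2) ^ k * (1/2))"
    by (subst measure_measure_pmf_finite) simp_all
  also have "\<dots> = 1 - 1 / 2 ^ n"
    by (induction n) (simp_all add: field_simps)
  finally show ?thesis
    using measure_pmf.prob_compl[of "{..<n}" "geometric_pmf (1/2)"]
    by (simp add: Compl_eq_Diff_UNIV[symmetric] Compl_lessThan)
qed

lemma expectation_block_pmf:
  fixes f :: "int perm \<times> int \<Rightarrow> real"
  assumes "\<And>g. 0 \<le> f g" "\<And>g. f g \<le> 1"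
  shows "measure_pmf.expectation (block_pmf m) f =
    measure_pmf.expectation (pmf_of_set {- m..m}) (\<lambda>x.
      measure_pmf.expectation (pmf_of_set (box_perms (3 * m))) (\<lambda>p.
        measure_pmf.expectation (pmf_of_set {- m..m}) (\<lambda>z. f (translate_perm x p, x + z))))"
  using assms by (simp add: block_pmf_def expectation_bind_pmf_unit)

lemma expectation_shuffler_pmf:
  fixes f :: "int perm \<times> int \<Rightarrow> real"
  assumes "\<And>g. 0 \<le> f g" "\<And>g. f g \<le> 1"
  shows "measure_pmf.expectation shuffler_pmf f =
    measure_pmf.expectation (geometric_pmf (1/2))
      (\<lambda>i. measure_pmf.expectation (block_pmf (block_scale i)) f)"
  using assms by (simp add: shuffler_pmf_def expectation_bind_pmf_unit)

section \<open>Transience of the projection\<close>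

text \<open>Either all \<open>k\<close> steps have index below \<open>n\<close>, or some block
  smears the position over an interval with at least \<open>block_scale n\<close> points. Uniformity
  in \<open>z\<close> lets the induction condition on the first step.\<close>

lemma projected_walk_concentration:
  "measure (iid (map_pmf snd shuffler_pmf)) {\<omega>. walk_position integer_group \<omega> k = z} \<le>
    (1 - 1 / 2 ^ n) ^ k + 1 / block_scale n"
proof (induction k arbitrary: z)
  case 0
  interpret I: prob_space "iid (map_pmf snd shuffler_pmf)" by (rule prob_space_iid)
  show ?case
    by (rule order_trans[OF I.prob_le_1]) simp
next
  case (Suc k)
  interpret I: prob_space "iid (map_pmf snd shuffler_pmf)" by (rule prob_space_iid)
  let ?W = "\<lambda>z. {\<omega>. walk_position integer_group \<omega> k = z}"
  define q where "q z = measure (iid (map_pmf snd shuffler_pmf)) (?W z)" for z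
  have q: "0 \<le> q z" "q z \<le> 1" for z
    by (simp_all add: q_def)
  define X where "X i = measure_pmf.expectation (block_pmf (block_scale i)) (\<lambda>g. q (z - snd g))" for i
  have X: "0 \<le> X i" "X i \<le> 1" for i
    unfolding X_def by (auto intro!: expectation_unit q)
  have "measure (iid (map_pmf snd shuffler_pmf)) {\<omega>. walk_position integer_group \<omega> (Suc k) = z} =
      measure_pmf.expectation shuffler_pmf (\<lambda>g. q (z - snd g))"
    by (subst group.measure_walk_position_Suc) (simp_all add: q_def del: walk_position.simps)
  also have "\<dots> = measure_pmf.expectation (geometric_pmf (1/2)) X"
    unfolding X_def by (rule expectation_shuffler_pmf) (simp_all add: q)
  also have "\<dots> \<le> (1 - measure_pmf.prob (geometric_pmf (1/2)) {n..}) * ((1 - 1 / 2 ^ n) ^ k + 1 / block_scale n)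
      + measure_pmf.prob (geometric_pmf (1/2)) {n..} * (1 / block_scale n)"
  proof (rule expectation_le_threshold)
    show "\<bar>X i\<bar> \<le> 1" for i using X[of i] by simp
    show "X i \<le> (1 - 1 / 2 ^ n) ^ k + 1 / block_scale n" for i
      unfolding X_def using Suc q by (intro measure_pmf.integral_le_const) (auto simp: q_def)
    show "X i \<le> 1 / block_scale n" if "n \<le> i" for i
    proof -
      define m where "m = block_scale i"
      have m: "0 < m" "block_scale n \<le> m" using block_scale_mono[OF that] by (simp_all add: m_def)
      \<comment> \<open>One uniform translation suffices: the summed probabilities belong to
        disjoint events, so their average is at most one over the length of the interval.\<close>
      have inner: "measure_pmf.expectation (pmf_of_set {- m..m}) (\<lambda>y. q (z - (x + y))) \<le> 1 / block_scale n" for x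
      proof -
        have "(\<Sum>y\<in>{- m..m}. q (z - (x + y))) =
            measure (iid (map_pmf snd shuffler_pmf)) (\<Union>y\<in>{- m..m}. ?W (z - (x + y)))"
          unfolding q_def
          by (intro I.finite_measure_finite_Union[symmetric])
            (auto simp: disjoint_family_on_def intro!: walk_position_in_sets)
        also have "\<dots> \<le> 1" by simp
        finally have "measure_pmf.expectation (pmf_of_set {- m..m}) (\<lambda>y. q (z - (x + y))) \<le> 1 / real (card {- m..m})"
          using m by (simp add: integral_pmf_of_set divide_right_mono)
        also have "\<dots> \<le> 1 / block_scale n"
          using m by (intro divide_left_mono) (auto intro!: mult_pos_pos)
        finally show ?thesis .
      qed
      have "X i = measure_pmf.expectation (pmf_of_set {- m..m}) (\<lambda>x.
         measure_pmf.expectation (pmf_of_set {- m..m}) (\<lambda>y. q (z - (x + y))))"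
        unfolding X_def m_def[symmetric] using q by (subst expectation_block_pmf) simp_all
      also have "\<dots> \<le> 1 / block_scale n"
        by (rule measure_pmf.integral_le_const) (use q inner in \<open>auto simp: expectation_unit\<close>)
      finally show ?thesis .
    qed
  qed
  also have "\<dots> = (1 - 1 / 2 ^ n) ^ Suc k + 1 / block_scale n"
    by (simp add: prob_geometric_half_atLeast algebra_simps)
  finally show ?case .
qed

text \<open>Balancing the two terms: \<open>2 ^ n\<close> is taken within a factor 2 below the
  square root of the time, so the chance of seeing only small blocks is at most
  \<open>exp (- sqrt (real (Suc k)))\<close>.\<close>

lemma projected_walk_return_bound:
  "measure (iid (map_pmf snd shuffler_pmf)) {\<omega>. walk_position integer_group \<omega> (Suc k) = 0} \<le>
    exp (- sqrt (real (Suc k))) + 16 / (real (Suc k))\<^sup>2"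
proof -
  define n where "n = nat \<lfloor>log 2 (sqrt (real (Suc k)))\<rfloor>"
  have l: "0 \<le> log 2 (sqrt (real (Suc k)))" by simp
  then have n: "real n = real_of_int \<lfloor>log 2 (sqrt (real (Suc k)))\<rfloor>" by (simp add: n_def)
  have "2 powr real n \<le> 2 powr (log 2 (sqrt (real (Suc k))))"
    using n by (intro powr_mono) auto
  then have up: "2 ^ n \<le> sqrt (real (Suc k))"
    by (simp add: powr_realpow)
  have "2 powr (log 2 (sqrt (real (Suc k)))) \<le> 2 powr real (Suc n)"
    unfolding of_nat_Suc[of n] n by (intro powr_mono) linarith+
  then have lo: "sqrt (real (Suc k)) \<le> 2 * 2 ^ n"
    by (simp add: powr_add powr_realpow)
  have "(1 - 1 / 2 ^ n) ^ Suc k \<le> exp (- (1 / 2 ^ n) :: real) ^ Suc k"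
    using exp_ge_add_one_self[of "- (1 / 2 ^ n)"] by (intro power_mono) (auto simp: field_simps)
  also have "\<dots> = exp (- (real (Suc k) / 2 ^ n))"
    by (subst exp_of_nat_mult[symmetric]) simp
  also have "\<dots> \<le> exp (- sqrt (real (Suc k)))"
  proof -
    have "sqrt (real (Suc k)) * 2 ^ n \<le> sqrt (real (Suc k)) * sqrt (real (Suc k))"
      by (intro mult_left_mono up) simp
    then show ?thesis by (simp add: field_simps)
  qed
  finally have 1: "(1 - 1 / 2 ^ n) ^ Suc k \<le> exp (- sqrt (real (Suc k)))" .
  \<comment> \<open>The scale is at least \<open>16 ^ n\<close>, the fourth power of
    \<open>2 ^ n\<close>, hence of the order of the squared time.\<close>
  have "(real (Suc k))\<^sup>2 = sqrt (real (Suc k)) ^ 4"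
    by (simp add: power4_eq_xxxx power2_eq_square)
  also have "\<dots> \<le> (2 * 2 ^ n) ^ 4"
    by (intro power_mono lo) simp
  also have "\<dots> = 16 * 16 ^ n"
  proof -
    have "(2 ^ n :: real) ^ 4 = (2 ^ 4) ^ n"
      by (simp only: mult.commute flip: power_mult)
    then show ?thesis by (simp add: power_mult_distrib)
  qed
  also have "\<dots> \<le> 16 * real_of_int (block_scale n)"
    by (simp add: block_scale_def power_increasing power2_eq_square)
  finally have 2: "1 / real_of_int (block_scale n) \<le> 16 / (real (Suc k))\<^sup>2"
    by (simp add: field_simps)
  show ?thesis
    using projected_walk_concentration[of "Suc k" 0 n] 1 2 by linarith
qed

lemma transient_projected_walk: "transient_walk integer_group (map_pmf snd shuffler_pmf)"
proof (rule transient_walkI)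
  show "countable (UNIV :: int set)" by simp
  have "summable (\<lambda>k. exp (- sqrt (real (Suc k))) + 16 / (real (Suc k))\<^sup>2)"
  proof (rule summable_comparison_test_bigo)
    show "summable (\<lambda>k. norm (1 / (real (Suc k))\<^sup>2))"
      using inverse_squares_sums by (simp add: sums_iff)
    show "(\<lambda>k. exp (- sqrt (real (Suc k))) + 16 / (real (Suc k))\<^sup>2) \<in> O(\<lambda>k. 1 / (real (Suc k))\<^sup>2)"
      by real_asymp
  qed
  then show "summable (\<lambda>n. measure (iid (map_pmf snd shuffler_pmf))
      {\<omega>. walk_position integer_group \<omega> (Suc n) = \<one>\<^bsub>integer_group\<^esub>})"
    by (rule summable_comparison_test'[where N = 0])
      (use projected_walk_return_bound in \<open>simp del: walk_position.simps of_nat_Suc\<close>)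
qed

section \<open>The Liouville property\<close>

text \<open>The translated windows share their common part. As \<open>F\<close> is nonnegative, only
  the points of the first window outside the second count, and there are at most
  \<open>\<bar>y - z\<bar>\<close> of them.\<close>

lemma expectation_interval_translate:
  fixes F :: "int \<Rightarrow> real"
  assumes F: "\<And>x. 0 \<le> F x" "\<And>x. F x \<le> 1" and m: "0 \<le> m"
  shows "measure_pmf.expectation (pmf_of_set {- m..m}) (\<lambda>x. F (x + y)) -
    measure_pmf.expectation (pmf_of_set {- m..m}) (\<lambda>x. F (x + z)) \<le> \<bar>y - z\<bar> / (2 * m + 1)"
proof -
  let ?A = "\<lambda>y. {- m + y..m + y}"
  have shift: "(\<Sum>x\<in>{- m..m}. F (x + y)) = sum F (?A y)" for y
    by (rule sum.reindex_bij_witness[where i = "\<lambda>x. x - y" and j = "\<lambda>x. x + y"]) auto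
  have "sum F (?A y) - sum F (?A z) = sum F (?A y - ?A z) - sum F (?A z - ?A y)"
    using sum.Int_Diff[of "?A y" F "?A z"] sum.Int_Diff[of "?A z" F "?A y"]
    by (simp only: Int_commute finite_atLeastAtMost_int)
  also have "\<dots> \<le> sum F (?A y - ?A z)"
    using F by (simp add: sum_nonneg)
  also have "\<dots> \<le> real (card (?A y - ?A z))"
    using sum_bounded_above[of "?A y - ?A z" F 1] F by simp
  also have "card (?A y - ?A z) \<le> card (if y \<le> z then {- m + y..<- m + z} else {m + z<..m + y})"
    by (intro card_mono) auto
  also have "\<dots> = nat \<bar>y - z\<bar>" by simp
  finally have "sum F (?A y) - sum F (?A z) \<le> \<bar>y - z\<bar>" by simp
  then show ?thesis
    using m by (simp add: integral_pmf_of_set shift diff_divide_distrib[symmetric] divide_right_mono)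
qed

text \<open>Moving \<open>q\<close> past the translation turns it into a conjugate \<open>r\<close>
  multiplying \<open>p\<close>, which the uniform permutation absorbs; only the shift by
  \<open>y\<close> survives.\<close>

lemma expectation_block_pmf_translate:
  fixes f :: "int perm \<times> int \<Rightarrow> real"
  assumes f: "\<And>g. 0 \<le> f g" "\<And>g. f g \<le> 1"
    and g: "(q, y) \<in> shuffler_ball m"
  shows "measure_pmf.expectation (block_pmf m) (\<lambda>h. f ((q, y) \<otimes>\<^bsub>shuffler_Z\<^esub> h)) =
    measure_pmf.expectation (pmf_of_set {- m..m}) (\<lambda>x.
      measure_pmf.expectation (pmf_of_set (box_perms (3 * m))) (\<lambda>p.
        measure_pmf.expectation (pmf_of_set {- m..m}) (\<lambda>z.
          f (translate_perm (x + y) p, x + y + z))))"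
proof -
  have q: "q \<in> box_perms m" and y: "\<bar>y\<bar> \<le> m" using g by (auto simp: shuffler_ball_def)
  have absorb: "measure_pmf.expectation (pmf_of_set (box_perms (3 * m))) (\<lambda>p.
        measure_pmf.expectation (pmf_of_set {- m..m}) (\<lambda>z. f ((q, y) \<otimes>\<^bsub>shuffler_Z\<^esub> (translate_perm x p, x + z)))) =
      measure_pmf.expectation (pmf_of_set (box_perms (3 * m))) (\<lambda>p.
        measure_pmf.expectation (pmf_of_set {- m..m}) (\<lambda>z. f (translate_perm (x + y) p, x + y + z)))"
    if "x \<in> {- m..m}" for x
  proof -
    define r where "r = translate_perm (- (x + y)) q"
    \<comment> \<open>This fixes the box radius: \<open>\<bar>x + y\<bar>\<close> is at most
      \<open>2 * m\<close>, and \<open>q\<close> has radius \<open>m\<close>.\<close>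
    have r: "r \<in> box_perms (3 * m)"
      unfolding r_def using q y that by (intro box_perms_translate[where R = m]) auto
    have "q * translate_perm y (translate_perm x p) = translate_perm (x + y) (r * p)" for p
      by (simp add: r_def translate_perm_mult flip: translate_perm_add) (simp add: add.commute)
    then have eq: "(q, y) \<otimes>\<^bsub>shuffler_Z\<^esub> (translate_perm x p, x + z) = (translate_perm (x + y) (r * p), x + y + z)" for p z
      by simp
    have "map_pmf ((*) r) (pmf_of_set (box_perms (3 * m))) = pmf_of_set (box_perms (3 * m))"
      using r by (intro map_pmf_of_set_bij_betw)
        (auto intro!: bij_betwI[where g = "(*) (inverse r)"] box_perms_mult simp flip: mult.assoc)
    then have "measure_pmf.expectation (pmf_of_set (box_perms (3 * m))) (\<lambda>p. \<phi> (r * p)) =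
        measure_pmf.expectation (pmf_of_set (box_perms (3 * m))) \<phi>" for \<phi> :: "int perm \<Rightarrow> real"
      by (metis integral_map_pmf)
    then show ?thesis
      unfolding eq .
  qed
  have "measure_pmf.expectation (block_pmf m) (\<lambda>h. f ((q, y) \<otimes>\<^bsub>shuffler_Z\<^esub> h)) =
    measure_pmf.expectation (pmf_of_set {- m..m}) (\<lambda>x.
      measure_pmf.expectation (pmf_of_set (box_perms (3 * m))) (\<lambda>p.
        measure_pmf.expectation (pmf_of_set {- m..m}) (\<lambda>z.
          f ((q, y) \<otimes>\<^bsub>shuffler_Z\<^esub> (translate_perm x p, x + z)))))"
    by (rule expectation_block_pmf) (rule f)+
  also have "\<dots> = measure_pmf.expectation (pmf_of_set {- m..m}) (\<lambda>x.
      measure_pmf.expectation (pmf_of_set (box_perms (3 * m))) (\<lambda>p.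
        measure_pmf.expectation (pmf_of_set {- m..m}) (\<lambda>z.
          f (translate_perm (x + y) p, x + y + z))))"
    using y by (intro integral_cong_AE) (auto simp: AE_measure_pmf_iff absorb simp del: mult_shuffler_Z)
  finally show ?thesis .
qed

text \<open>Once the permutations are absorbed, the two starts differ only by a shift of at most
  \<open>2 * r\<close> in a window of \<open>2 * m + 1\<close> points.\<close>

lemma block_pmf_almost_invariant:
  fixes f :: "int perm \<times> int \<Rightarrow> real"
  assumes f: "\<And>g. 0 \<le> f g" "\<And>g. f g \<le> 1"
    and g: "g \<in> shuffler_ball r" "g' \<in> shuffler_ball r" and r: "r \<le> m"
  shows "measure_pmf.expectation (block_pmf m) (\<lambda>h. f (g \<otimes>\<^bsub>shuffler_Z\<^esub> h)) -
    measure_pmf.expectation (block_pmf m) (\<lambda>h. f (g' \<otimes>\<^bsub>shuffler_Z\<^esub> h)) \<le> r / m"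
proof -
  obtain q y q' y' where gg: "g = (q, y)" "g' = (q', y')" by fastforce
  define F where "F t = measure_pmf.expectation (pmf_of_set (box_perms (3 * m))) (\<lambda>p.
        measure_pmf.expectation (pmf_of_set {- m..m}) (\<lambda>z. f (translate_perm t p, t + z)))" for t
  have F: "0 \<le> F t" "F t \<le> 1" for t
    unfolding F_def using f by (auto intro!: expectation_unit)
  have y: "\<bar>y\<bar> \<le> r" "\<bar>y'\<bar> \<le> r" using g by (auto simp: gg shuffler_ball_def)
  have ball: "(q, y) \<in> shuffler_ball m" "(q', y') \<in> shuffler_ball m"
    using g r box_perms_translate[of q r 0 m] box_perms_translate[of q' r 0 m]
    by (auto simp: gg shuffler_ball_def)
  have "measure_pmf.expectation (block_pmf m) (\<lambda>h. f (g \<otimes>\<^bsub>shuffler_Z\<^esub> h)) =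
      measure_pmf.expectation (pmf_of_set {- m..m}) (\<lambda>x. F (x + y))"
    unfolding gg F_def by (rule expectation_block_pmf_translate[OF f ball(1)])
  moreover have "measure_pmf.expectation (block_pmf m) (\<lambda>h. f (g' \<otimes>\<^bsub>shuffler_Z\<^esub> h)) =
      measure_pmf.expectation (pmf_of_set {- m..m}) (\<lambda>x. F (x + y'))"
    unfolding gg F_def by (rule expectation_block_pmf_translate[OF f ball(2)])
  ultimately have "measure_pmf.expectation (block_pmf m) (\<lambda>h. f (g \<otimes>\<^bsub>shuffler_Z\<^esub> h)) -
    measure_pmf.expectation (block_pmf m) (\<lambda>h. f (g' \<otimes>\<^bsub>shuffler_Z\<^esub> h)) \<le> \<bar>y - y'\<bar> / (2 * m + 1)"
    using expectation_interval_translate[of F m y y'] F y r by simp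
  also have "\<dots> \<le> real_of_int (2 * r) / real_of_int (2 * m)"
  \<comment> \<open>For \<open>m = 0\<close> also \<open>r = 0\<close>, both shifts vanish, and
    division by zero yields 0.\<close>
  proof (cases "m = 0")
    case True
    then show ?thesis using y r by simp
  next
    case False
    then show ?thesis using y r by (intro frac_le) auto
  qed
  finally show ?thesis by simp
qed

text \<open>
  Expand a harmonic function along the first \<open>k\<close> steps of the walk until a block of index
  at least \<open>n\<close> occurs, which happens with high probability; that block forgets the
  starting point, as the earlier, smaller blocks have moved the walk only by a distance at most \<open>\<rho>\<close>.
\<close>

lemma harmonic_oscillation:
  fixes f :: "int perm \<times> int \<Rightarrow> real"
  assumes f: "\<And>g. 0 \<le> f g" "\<And>g. f g \<le> 1"
    and harmonic: "\<And>g. f g = measure_pmf.expectation shuffler_pmf (\<lambda>h. f (g \<otimes>\<^bsub>shuffler_Z\<^esub> h))"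
    and \<rho>: "\<rho> \<le> block_scale (Suc n)"
    and "g \<in> shuffler_ball r" "g' \<in> shuffler_ball r" "r + int k * (4 * block_scale n) \<le> \<rho>"
  shows "f g - f g' \<le> (1 - 1 / 2 ^ Suc n) ^ k + \<rho> / block_scale (Suc n)"
  using assms(5-)
\<comment> \<open>The radius \<open>r\<close> grows with each small block while
  \<open>\<rho>\<close> and \<open>n\<close> stay fixed: \<open>\<rho>\<close> is the total
  displacement budget.\<close>
proof (induction k arbitrary: g g' r)
  case 0
  have "0 \<le> \<rho>" using 0 by (cases g) (auto simp: shuffler_ball_def)
  then show ?case
    using f(2)[of g] f(1)[of g'] by (simp add: add_increasing2)
next
  case (Suc k)
  define X where "X i = measure_pmf.expectation (block_pmf (block_scale i)) (\<lambda>h. f (g \<otimes>\<^bsub>shuffler_Z\<^esub> h)) -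
    measure_pmf.expectation (block_pmf (block_scale i)) (\<lambda>h. f (g' \<otimes>\<^bsub>shuffler_Z\<^esub> h))" for i
  have r: "r \<le> \<rho>"
    using Suc.prems(3) block_scale_pos(2)[of n] by (smt (verit) mult_nonneg_nonneg of_nat_0_le_iff)
  have "f g - f g' = measure_pmf.expectation (geometric_pmf (1/2)) X"
    unfolding X_def
    by (subst (1 2) harmonic) (simp add: expectation_shuffler_pmf expectation_unit f)
  also have "\<dots> \<le> (1 - measure_pmf.prob (geometric_pmf (1/2)) {Suc n..}) *
        ((1 - 1 / 2 ^ Suc n) ^ k + \<rho> / block_scale (Suc n))
      + measure_pmf.prob (geometric_pmf (1/2)) {Suc n..} * (\<rho> / block_scale (Suc n))"
  proof (rule expectation_le_threshold)
    have unit: "0 \<le> measure_pmf.expectation (block_pmf (block_scale i)) (\<lambda>h. f (g \<otimes>\<^bsub>shuffler_Z\<^esub> h))"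
      "measure_pmf.expectation (block_pmf (block_scale i)) (\<lambda>h. f (g \<otimes>\<^bsub>shuffler_Z\<^esub> h)) \<le> 1" for i g
      by (intro expectation_unit f)+
    show "\<bar>X i\<bar> \<le> 1" for i
      using unit[of i g] unit[of i g'] unfolding X_def by linarith
    show "X i \<le> (1 - 1 / 2 ^ Suc n) ^ k + \<rho> / block_scale (Suc n)" if "i < Suc n" for i
    proof -
      \<comment> \<open>Both walks are coupled by the same increment \<open>h\<close>, which uses at
        most \<open>4 * block_scale n\<close> of the budget.\<close>
      have "f (g \<otimes>\<^bsub>shuffler_Z\<^esub> h) - f (g' \<otimes>\<^bsub>shuffler_Z\<^esub> h) \<le> (1 - 1 / 2 ^ Suc n) ^ k + \<rho> / block_scale (Suc n)"
        if "h \<in> set_pmf (block_pmf (block_scale i))" for h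
      proof (rule Suc.IH)
        have "h \<in> shuffler_ball (4 * block_scale i)"
          using that set_block_pmf[of "block_scale i"] by auto
        then show "g \<otimes>\<^bsub>shuffler_Z\<^esub> h \<in> shuffler_ball (r + 4 * block_scale i)"
          "g' \<otimes>\<^bsub>shuffler_Z\<^esub> h \<in> shuffler_ball (r + 4 * block_scale i)"
          using Suc.prems by (auto intro!: shuffler_ball_mult)
        show "r + 4 * block_scale i + int k * (4 * block_scale n) \<le> \<rho>"
          using Suc.prems(3) block_scale_mono[of i n] \<open>i < Suc n\<close> by (simp add: algebra_simps)
      qed
      then have "measure_pmf.expectation (block_pmf (block_scale i))
          (\<lambda>h. f (g \<otimes>\<^bsub>shuffler_Z\<^esub> h) - f (g' \<otimes>\<^bsub>shuffler_Z\<^esub> h)) \<le> (1 - 1 / 2 ^ Suc n) ^ k + \<rho> / block_scale (Suc n)"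
        by (intro measure_pmf.integral_le_const) (simp_all add: AE_measure_pmf_iff f)
      moreover have "X i = measure_pmf.expectation (block_pmf (block_scale i))
          (\<lambda>h. f (g \<otimes>\<^bsub>shuffler_Z\<^esub> h) - f (g' \<otimes>\<^bsub>shuffler_Z\<^esub> h))"
        by (simp add: X_def f)
      ultimately show ?thesis by simp
    qed
    show "X i \<le> \<rho> / block_scale (Suc n)" if "Suc n \<le> i" for i
    proof -
      have m: "block_scale (Suc n) \<le> block_scale i" by (rule block_scale_mono[OF that])
      have "0 \<le> r" using Suc.prems by (cases g) (auto simp: shuffler_ball_def)
      have "X i \<le> r / block_scale i"
        unfolding X_def by (rule block_pmf_almost_invariant) (use f Suc.prems r \<rho> m in auto)
      also have "\<dots> \<le> \<rho> / block_scale (Suc n)"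
        using r m \<open>0 \<le> r\<close> by (intro frac_le) auto
      finally show ?thesis .
    qed
  qed
  also have "\<dots> = (1 - 1 / 2 ^ Suc n) ^ Suc k + \<rho> / block_scale (Suc n)"
    by (simp add: prob_geometric_half_atLeast algebra_simps)
  finally show ?case .
qed

text \<open>Waiting \<open>4 ^ Suc n\<close> steps makes both error terms vanish as \<open>n\<close>
  grows. The inequality is one-sided, but exchanging \<open>g\<close> and \<open>g'\<close> gives
  equality.\<close>

lemma harmonic_le:
  fixes f :: "int perm \<times> int \<Rightarrow> real"
  assumes f: "\<And>g. 0 \<le> f g" "\<And>g. f g \<le> 1"
    and harmonic: "\<And>g. f g = measure_pmf.expectation shuffler_pmf (\<lambda>h. f (g \<otimes>\<^bsub>shuffler_Z\<^esub> h))"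
  shows "f g \<le> f g'"
proof -
  obtain r1 r2 where "g \<in> shuffler_ball r1" "g' \<in> shuffler_ball r2" "0 \<le> r1" "0 \<le> r2"
    using shuffler_ball_exhausts by meson
  then obtain r where r: "g \<in> shuffler_ball r" "g' \<in> shuffler_ball r"
    using box_perms_translate[of "fst g" r1 0 "max r1 r2"] box_perms_translate[of "fst g'" r2 0 "max r1 r2"]
    by (intro that[of "max r1 r2"]) (auto simp: shuffler_ball_def mem_Times_iff)
  \<comment> \<open>A bound on the radius after \<open>4 ^ Suc n\<close> blocks of index at most
    \<open>n\<close>.\<close>
  define \<rho> where "\<rho> n = r + int (4 ^ Suc n) * (4 * block_scale n)" for n
  have \<rho>_eq: "real_of_int (\<rho> n) / block_scale (Suc n) = r / block_scale (Suc n) + (1 / 64) ^ n" for n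
  proof -
    have "(Suc n)\<^sup>2 = n\<^sup>2 + n + n + 1" by (simp add: power2_eq_square)
    \<comment> \<open>The factor \<open>16 * 4 ^ n\<close> pays for the accumulated displacement;
      \<open>64 ^ n\<close> is the surplus that drives the ratio to 0.\<close>
    then have "block_scale (Suc n) = 16 * 4 ^ n * 64 ^ n * block_scale n"
      by (simp add: block_scale_def power_add flip: power_mult_distrib)
    then have "real_of_int (block_scale (Suc n)) = 64 ^ n * (16 * 4 ^ n * block_scale n)"
      by simp
    moreover have "real_of_int (\<rho> n) = r + 16 * 4 ^ n * block_scale n"
      by (simp add: \<rho>_def)
    moreover have "real_of_int (block_scale n) \<noteq> 0"
      using block_scale_pos(1)[of n] by linarith
    ultimately show ?thesis
      by (simp add: add_divide_distrib power_one_over)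
  qed
  have "filterlim (\<lambda>n. real_of_int (block_scale (Suc n))) at_top sequentially"
  proof (rule filterlim_at_top_mono[OF filterlim_real_sequentially])
    have "int n \<le> block_scale (Suc n)" for n
      using block_scale_ge[of "Suc n"] by simp
    then show "\<forall>\<^sub>F n in sequentially. real n \<le> real_of_int (block_scale (Suc n))"
      by (intro always_eventually allI) (metis of_int_le_iff of_int_of_nat_eq)
  qed
  then have "(\<lambda>n. r / real_of_int (block_scale (Suc n))) \<longlonglongrightarrow> 0"
    by (intro real_tendsto_divide_at_top[OF tendsto_const])
  from tendsto_add[OF this LIMSEQ_power_zero[of "1 / 64 :: real"]]
  have \<rho>_lim: "(\<lambda>n. real_of_int (\<rho> n) / block_scale (Suc n)) \<longlonglongrightarrow> 0"
    by (simp add: \<rho>_eq)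
  have exp_lim: "(\<lambda>n. exp (- ((2 :: real) ^ Suc n))) \<longlonglongrightarrow> 0"
    by real_asymp
  have bound: "\<forall>\<^sub>F n in sequentially. f g - f g' \<le> exp (- ((2 :: real) ^ Suc n)) + real_of_int (\<rho> n) / block_scale (Suc n)"
  \<comment> \<open>Only for large \<open>n\<close> is \<open>\<rho> n\<close> at most the next
    scale, as \<open>harmonic_oscillation\<close> demands.\<close>
  proof (rule eventually_mono)
    show "\<forall>\<^sub>F n in sequentially. real_of_int (\<rho> n) / block_scale (Suc n) < 1"
      by (rule order_tendstoD(2)[OF \<rho>_lim]) simp
    fix n assume "real_of_int (\<rho> n) / block_scale (Suc n) < 1"
    then have "\<rho> n \<le> block_scale (Suc n)" by (simp add: field_simps)
    then have "f g - f g' \<le> (1 - 1 / 2 ^ Suc n) ^ (4 ^ Suc n) + \<rho> n / block_scale (Suc n)"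
      by (rule harmonic_oscillation[OF f harmonic _ r]) (simp add: \<rho>_def)
    also have "(1 - 1 / 2 ^ Suc n) ^ (4 ^ Suc n) \<le> exp (- (1 / 2 ^ Suc n) :: real) ^ (4 ^ Suc n)"
      using exp_ge_add_one_self[of "- (1 / 2 ^ Suc n)"] one_le_power[of "2 :: real" "Suc n"]
      by (intro power_mono) (simp_all add: divide_le_eq del: power_Suc)
    also have "\<dots> = exp (- ((2 :: real) ^ Suc n))"
    proof -
      have "(4 :: real) ^ Suc n = 2 ^ Suc n * 2 ^ Suc n"
        by (simp flip: power_mult_distrib)
      then show ?thesis
        by (subst exp_of_nat_mult[symmetric]) (simp del: power_Suc)
    qed
    finally show "f g - f g' \<le> exp (- ((2 :: real) ^ Suc n)) + real_of_int (\<rho> n) / block_scale (Suc n)"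
      by simp
  qed
  have "(\<lambda>n. exp (- ((2 :: real) ^ Suc n)) + real_of_int (\<rho> n) / block_scale (Suc n)) \<longlonglongrightarrow> 0"
    using tendsto_add[OF exp_lim \<rho>_lim] by simp
  then have "f g - f g' \<le> 0"
    by (rule tendsto_lowerbound[OF _ bound]) simp
  then show ?thesis by simp
qed

lemma trivial_boundary_shuffler_pmf: "poisson_boundary_trivial shuffler_Z shuffler_pmf"
proof (rule group.poisson_boundary_trivialI[OF group_shuffler_Z countable_shuffler])
  fix h :: "int perm \<times> int \<Rightarrow> real" and a
  assume "\<And>a. 0 \<le> h a" "\<And>a. h a \<le> 1"
    "\<And>a. h a = measure_pmf.expectation shuffler_pmf (\<lambda>s. h (a \<otimes>\<^bsub>shuffler_Z\<^esub> s))"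
  note le = harmonic_le[of h, OF this]
  show "h a = h \<one>\<^bsub>shuffler_Z\<^esub>" by (rule antisym) (rule le)+
qed simp

theorem proposition4p8:
  shows "\<exists>\<mu> :: (int perm \<times> int) pmf.
    symmetric_pmf shuffler_Z \<mu> \<and>
    nondegenerate_pmf shuffler_Z \<mu> \<and>
    transient_walk integer_group (map_pmf snd \<mu>) \<and>
    poisson_boundary_trivial shuffler_Z \<mu>"
  using symmetric_shuffler_pmf nondegenerate_shuffler_pmf transient_projected_walk
    trivial_boundary_shuffler_pmf by blast

end
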